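(* Let $m,n,k$ be nonnegative integers such that $n \geq m+k$. Let $f_k^{m+1}(n)$ denote the coefficient of $q^k$ in the polynomial $G_n^{m+1}$ (the generalized Galois number of $(m+1,n)$), regarded as a function of $n$. Then $$\nabla^{m} f_k^{m+1}(n) = \left| \mathcal{P}_k^{m} \right|,$$ where $\nabla^m$ is the $m$-th finite (backward) difference in the variable $n$ and $\mathcal{P}_k^m$ is the set of integer partitions of $k$ with $m$ kinds.
   Context: $[n]=\{1,\ldots,n\}$ and $q$ is an indeterminate. $q$-binomial coefficients: for nonnegative integers $n\ge k$, $\binom{n}{k}_q := \sum_{E\subseteq [n],\,|E|=k} q^{\sum_{i=1}^k ((n-e_i)-(k-i))}$, where $E=\{e_1<\cdots<e_k\}$. $q$-multinomial coefficients: for nonnegative integers with $k_1+\cdots+k_m=n$, $\binom{n}{k_1,\ldots,k_m}_q := \binom{n}{k_m}_q\binom{n-k_m}{k_{m-1}}_q\cdots\binom{n-k_m-\cdots-k_2}{k_1}_q$. Generalized Galois number: for nonnegative integers $m,n$, $G_n^m := \sum_{k_1+\cdots+k_m=n,\ k_i\ge 0} \binom{n}{k_1,\ldots,k_m}_q$, a polynomial in $q$. Finite difference: $\nabla f(n) := f(n)-f(n-1)$, $\nabla^0 f := f$, $\nabla^m f := \nabla(\nabla^{m-1} f)$; thus $\nabla^m f(n)=\sum_{i=0}^m (-1)^i\binom{m}{i} f(n-i)$. (Since $n\ge m+k$, only values $f_k^{m+1}(n-i)$ with $n-i\ge 0$ occur.) Integer partitions with kinds: an integer partition of $k$ with $m$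 kinds is an $m$-tuple $(P_1,\ldots,P_m)$ of (possibly empty) finite multisets of positive integers with $\sum_{i=1}^m\sum_{x\in P_i} x = k$ (sums with multiplicity). $\mathcal{P}_k^m$ is the set of all of them. For $m=0$ the only tuple is the empty tuple, with sum $0$. *)

theory Defs
  imports "HOL-Computational_Algebra.Polynomial" "HOL-Library.Multiset"
begin

text \<open>
  Polynomials in the indeterminate \<open>q\<close> are elements of \<^typ>\<open>int poly\<close>. The list
  \<open>sorted_list_of_set E\<close> is 0-based, so \<open>e\<^sub>i\<close> is its entry at position \<open>i - 1\<close>. The natural-number
  subtractions never truncate: \<open>n - e\<^sub>i\<close> is at least \<open>k - i\<close>, because the \<open>k - i\<close> elements
  \<open>e\<^sub>j\<close> with \<open>j > i\<close> all lie strictly between \<open>e\<^sub>i\<close> and \<open>n + 1\<close>.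
\<close>
definition q_binomial :: "nat \<Rightarrow> nat \<Rightarrow> int poly" where
  "q_binomial n k =
     (\<Sum>E | E \<subseteq> {1..n} \<and> card E = k.
        monom 1 (\<Sum>i = 1..k. (n - sorted_list_of_set E ! (i - 1)) - (k - i)))"

text \<open>
  The list \<open>ks\<close> is \<open>[k\<^sub>1, \<dots>, k\<^sub>m]\<close>, so \<open>ks ! i\<close> is \<open>k\<^sub>j\<close> with \<open>j = i + 1\<close>; its factor has upper entry
  \<open>n - k\<^sub>m - \<dots> - k\<^sub>j\<^sub>+\<^sub>1\<close>, and \<open>drop (Suc i) ks\<close> lists the numbers subtracted. Only used for
  \<open>sum_list ks = n\<close>.
\<close>
definition q_multinomial :: "nat \<Rightarrow> nat list \<Rightarrow> int poly" where
  "q_multinomial n ks =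
     (\<Prod>i<length ks. q_binomial (n - sum_list (drop (Suc i) ks)) (ks ! i))"

definition galois_number :: "nat \<Rightarrow> nat \<Rightarrow> int poly" where
  "galois_number m n = (\<Sum>ks | length ks = m \<and> sum_list ks = n. q_multinomial n ks)"

text \<open>
  At \<open>n = 0\<close> the truncating subtraction makes this \<open>0\<close>. The iterate \<open>(backward_diff ^^ m) f n\<close>
  evaluates \<open>f\<close> only at \<open>n, n - 1, \<dots>, n - m\<close>, so no truncation takes place when \<open>m \<le> n\<close>.
\<close>
definition backward_diff :: "(nat \<Rightarrow> int) \<Rightarrow> nat \<Rightarrow> int" where
  "backward_diff f n = f n - f (n - 1)"

definition partitions_with_kinds :: "nat \<Rightarrow> nat \<Rightarrow> nat multiset list set" where
  "partitions_with_kinds m k =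
     {Ps. length Ps = m \<and> (\<forall>P \<in> set Ps. \<forall>x \<in># P. 0 < x) \<and> (\<Sum>P\<leftarrow>Ps. sum_mset P) = k}"

end

theory Submission
  imports Defs
begin

text \<open>
  Write \<open>[n, j]\<close> for the \<open>q\<close>-binomial coefficient and \<open>G m n\<close> for the generalized Galois number.
  Splitting off the last part of a composition gives \<open>G (m+1) n = (\<Sum>j\<le>n. [n, j] G m (n-j))\<close>. Inserting
  the Pascal rule \<open>[n, j] = [n-1, j-1] + q\<^sup>j [n-1, j]\<close>, the first summand reassembles
  \<open>G (m+1) (n-1)\<close>, so that one backward difference lowers \<open>m\<close>:
  \<open>G (m+1) n - G (m+1) (n-1) = (\<Sum>j<n. q\<^sup>j [n-1, j] G m (n-j))\<close> (\<open>galois_number_diff\<close>).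

  The kernel \<open>q\<^sup>j [n-1, j]\<close> stabilizes: its coefficient at \<open>q\<^sup>c\<close> is, for \<open>c \<le> n-1\<close>, the number of
  partitions of \<open>c\<close> into exactly \<open>j\<close> parts (\<open>coeff_q_binomial_stable\<close>), because both numbers
  obey the same recursion. The coefficients of \<open>q\<^sup>k\<close> in the difference are therefore a convolution with
  weights that do not depend on \<open>n\<close> as soon as \<open>n > k\<close>, and as a partition of \<open>c\<close> has at most \<open>c\<close>
  parts, only indices \<open>j \<le> c\<close> contribute.

  By linearity, the remaining \<open>m-1\<close> differences pass through the convolution to the coefficient of
  \<open>q\<^bsup>k-c\<^esup>\<close> in \<open>G m (n-j)\<close>. Since \<open>j \<le> c\<close>, the pair \<open>(n-j, k-c)\<close> again satisfies the hypothesis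
  relating \<open>n\<close> and \<open>k\<close>, and induction on \<open>m\<close> turns each term into a number of partitions of \<open>k-c\<close>
  with \<open>m-1\<close> kinds. What remains is the count of partitions with \<open>m\<close> kinds according to the sum \<open>c\<close>
  and the number of parts \<open>j\<close> of the first component (\<open>card_partitions_with_kinds_Suc\<close>).
\<close>

section \<open>Gaussian binomials and Galois numbers\<close>

lemma q_binomial_0_right [simp]: "q_binomial n 0 = 1"
proof -
  have "{E. E \<subseteq> {1..n} \<and> card E = 0} = {{}}"
    by (auto dest: finite_subset)
  then show ?thesis
    by (simp add: q_binomial_def)
qed

lemma q_binomial_eq_0:
  assumes "n < k"
  shows "q_binomial n k = 0"
proof -
  have "card E \<noteq> k" if "E \<subseteq> {1..n}" for E
    using card_mono[OF _ that] assms by simp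
  then have "{E. E \<subseteq> {1..n} \<and> card E = k} = {}" by blast
  then show ?thesis
    unfolding q_binomial_def by (simp only: sum.empty)
qed

lemma sorted_list_of_set_insert_greatest:
  fixes x :: "'a :: linorder"
  assumes "finite A" "\<And>a. a \<in> A \<Longrightarrow> a < x"
  shows "sorted_list_of_set (insert x A) = sorted_list_of_set A @ [x]"
proof (rule sorted_distinct_set_unique)
  show "sorted (sorted_list_of_set A @ [x])"
    using assms by (auto simp: sorted_append less_imp_le)
  show "distinct (sorted_list_of_set A @ [x])"
    using assms by auto
  show "sorted (sorted_list_of_set (insert x A))"
    by (rule sorted_sorted_list_of_set)
  show "distinct (sorted_list_of_set (insert x A))"
    by (rule distinct_sorted_list_of_set)
  have "set (sorted_list_of_set (insert x A)) = insert x A"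
    using assms(1) by (intro set_sorted_list_of_set) simp
  then show "set (sorted_list_of_set (insert x A)) = set (sorted_list_of_set A @ [x])"
    using assms(1) by simp
qed

text \<open>
  The \<open>q\<close>-Pascal rule, by deciding whether the top element \<open>n + 1\<close> belongs to the subset. If it does,
  it is the last entry, has weight \<open>0\<close>, and removing it lowers \<open>n\<close> and \<open>k\<close> together, which leaves
  the other weights alone. If it does not, each of the \<open>k + 1\<close> weights drops by one on passing from
  \<open>n + 1\<close> to \<open>n\<close>.
\<close>
lemma q_binomial_Suc_Suc:
  "q_binomial (Suc n) (Suc k) = q_binomial n k + monom 1 (Suc k) * q_binomial n (Suc k)"
proof -
  define wt where "wt = (\<lambda>n k E. \<Sum>i = 1..k. (n - sorted_list_of_set E ! (i - 1)) - (k - i) :: nat)"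
  let ?S = "\<lambda>n k. {E :: nat set. E \<subseteq> {1..n} \<and> card E = k}"
  have fin: "finite (?S n k)" for n k
    by (rule finite_subset[of _ "Pow {1..n}"]) auto
  have mem: "sorted_list_of_set E ! (i - 1) \<in> E" if "E \<in> ?S n k" "i \<in> {1..k}" for E n k i
  proof -
    have "finite E" using that finite_subset by blast
    moreover have "sorted_list_of_set E ! (i - 1) \<in> set (sorted_list_of_set E)"
      by (rule nth_mem) (use that in auto)
    ultimately show ?thesis by simp
  qed
  have split: "?S (Suc n) (Suc k) = insert (Suc n) ` ?S n k \<union> ?S n (Suc k)"
  proof (intro equalityI subsetI)
    fix E assume E: "E \<in> ?S (Suc n) (Suc k)"
    then have "finite E" using finite_subset by blast
    show "E \<in> insert (Suc n) ` ?S n k \<union> ?S n (Suc k)"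
    proof (cases "Suc n \<in> E")
      case True
      then have "E = insert (Suc n) (E - {Suc n})" by blast
      moreover have "E - {Suc n} \<in> ?S n k"
        using E True \<open>finite E\<close> by (auto simp: atLeastAtMostSuc_conv)
      ultimately show ?thesis by blast
    qed (use E in \<open>auto simp: atLeastAtMostSuc_conv\<close>)
  next
    fix E assume "E \<in> insert (Suc n) ` ?S n k \<union> ?S n (Suc k)"
    then show "E \<in> ?S (Suc n) (Suc k)"
    proof
      assume "E \<in> insert (Suc n) ` ?S n k"
      then obtain F where F: "E = insert (Suc n) F" "F \<subseteq> {1..n}" "card F = k" by blast
      then have "finite F" "Suc n \<notin> F" using finite_subset[of F "{1..n}"] by auto
      then show ?thesis using F by auto
    qed auto
  qed
  have wt_insert: "wt (Suc n) (Suc k) (insert (Suc n) E) = wt n k E" if E: "E \<in> ?S n k" for E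
  proof -
    have "finite E" using E finite_subset by blast
    then have sl: "sorted_list_of_set (insert (Suc n) E) = sorted_list_of_set E @ [Suc n]"
      using E by (intro sorted_list_of_set_insert_greatest) auto
    have len: "length (sorted_list_of_set E) = k" using E by simp
    have "(\<Sum>i = 1..k. (Suc n - (sorted_list_of_set E @ [Suc n]) ! (i - 1)) - (Suc k - i)) = wt n k E"
      unfolding wt_def
    proof (rule sum.cong[OF refl])
      fix i assume i: "i \<in> {1..k}"
      have "sorted_list_of_set E ! (i - 1) \<le> n" using mem[OF E i] E by auto
      then show "(Suc n - (sorted_list_of_set E @ [Suc n]) ! (i - 1)) - (Suc k - i)
          = (n - sorted_list_of_set E ! (i - 1)) - (k - i)"
        using i len by (auto simp: nth_append)
    qed
    moreover have "(sorted_list_of_set E @ [Suc n]) ! k = Suc n"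
      using len by (metis nth_append_length)
    ultimately show ?thesis
      by (simp add: wt_def sl)
  qed
  have wt_avoid: "wt (Suc n) (Suc k) E = Suc k + wt n (Suc k) E" if E: "E \<in> ?S n (Suc k)" for E
  proof -
    let ?l = "sorted_list_of_set E"
    \<comment> \<open>The weights are truncated differences; the \<open>k + 1 - i\<close> entries after the \<open>i\<close>-th one fit
      between it and \<open>n\<close>, so nothing is truncated and the drop by one is genuine.\<close>
    have bound: "Suc k - i \<le> n - ?l ! (i - 1)" if i: "i \<in> {1..Suc k}" for i
    proof -
      have len: "length ?l = Suc k" using E by simp
      let ?a = "?l ! (i - 1)"
      have "(!) ?l ` {i..<Suc k} \<subseteq> {?a<..n}"
      proof
        fix y assume "y \<in> (!) ?l ` {i..<Suc k}"
        then obtain j where j: "i \<le> j" "j < Suc k" "y = ?l ! j" by auto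
        have "?a < y"
          using sorted_wrt_nth_less[OF strict_sorted_list_of_set[of E], of "i - 1" j] i j len by auto
        moreover have "y \<in> E" using mem[OF E, of "Suc j"] j by auto
        ultimately show "y \<in> {?a<..n}" using E by auto
      qed
      moreover have "inj_on ((!) ?l) {i..<Suc k}"
        using len by (intro inj_on_nth) auto
      ultimately have "card {i..<Suc k} \<le> card {?a<..n}"
        by (intro card_inj_on_le) auto
      then show ?thesis by simp
    qed
    have "wt (Suc n) (Suc k) E = (\<Sum>i = 1..Suc k. 1 + ((n - ?l ! (i - 1)) - (Suc k - i)))"
      unfolding wt_def
    proof (rule sum.cong[OF refl])
      fix i assume i: "i \<in> {1..Suc k}"
      have "?l ! (i - 1) \<le> n" using mem[OF E i] E by auto
      then show "(Suc n - ?l ! (i - 1)) - (Suc k - i) = 1 + ((n - ?l ! (i - 1)) - (Suc k - i))"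
        using bound[OF i] by linarith
    qed
    also have "\<dots> = Suc k + wt n (Suc k) E"
      unfolding wt_def by (subst sum.distrib) simp
    finally show ?thesis .
  qed
  have inj: "inj_on (insert (Suc n)) (?S n k)"
  proof (rule inj_onI)
    fix E F assume "E \<in> ?S n k" "F \<in> ?S n k" and eq: "insert (Suc n) E = insert (Suc n) F"
    then have "Suc n \<notin> E" "Suc n \<notin> F" by auto
    then show "E = F" using eq by (metis insert_ident)
  qed
  have "q_binomial (Suc n) (Suc k) = (\<Sum>E \<in> ?S (Suc n) (Suc k). monom 1 (wt (Suc n) (Suc k) E))"
    by (simp add: q_binomial_def wt_def)
  also have "\<dots> = (\<Sum>E \<in> insert (Suc n) ` ?S n k. monom 1 (wt (Suc n) (Suc k) E))
      + (\<Sum>E \<in> ?S n (Suc k). monom 1 (wt (Suc n) (Suc k) E))"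
    unfolding split by (rule sum.union_disjoint) auto
  also have "(\<Sum>E \<in> insert (Suc n) ` ?S n k. monom 1 (wt (Suc n) (Suc k) E))
      = (\<Sum>E \<in> ?S n k. monom 1 (wt n k E))"
    by (subst sum.reindex[OF inj]) (auto intro!: sum.cong simp: wt_insert)
  also have "\<dots> = q_binomial n k"
    by (simp add: q_binomial_def wt_def)
  also have "(\<Sum>E \<in> ?S n (Suc k). monom 1 (wt (Suc n) (Suc k) E))
      = (\<Sum>E \<in> ?S n (Suc k). monom 1 (Suc k) * monom (1 :: int) (wt n (Suc k) E))"
    by (intro sum.cong refl) (simp only: wt_avoid mult_monom mult_1)
  also have "\<dots> = monom 1 (Suc k) * q_binomial n (Suc k)"
    by (simp add: q_binomial_def wt_def sum_distrib_left)
  finally show ?thesis .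
qed

lemma q_binomial_self [simp]: "q_binomial n n = 1"
  by (induction n) (simp_all add: q_binomial_Suc_Suc q_binomial_eq_0)

lemma q_multinomial_snoc:
  "q_multinomial n (ks @ [j]) = q_binomial n j * q_multinomial (n - j) ks"
proof -
  have "n - sum_list (drop (Suc i) (ks @ [j])) = n - j - sum_list (drop (Suc i) ks)"
    if "i < length ks" for i
    using that by simp
  then have "(\<Prod>i<length ks. q_binomial (n - sum_list (drop (Suc i) (ks @ [j]))) ((ks @ [j]) ! i))
      = q_multinomial (n - j) ks"
    unfolding q_multinomial_def by (intro prod.cong) (auto simp: nth_append)
  then show ?thesis
    by (simp add: q_multinomial_def mult.commute)
qed

lemma finite_compositions: "finite {ks :: nat list. length ks = m \<and> sum_list ks = n}"
proof (rule finite_subset)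
  show "{ks. length ks = m \<and> sum_list ks = n} \<subseteq> {ks. set ks \<subseteq> {..n} \<and> length ks = m}"
    using member_le_sum_list by fastforce
qed (simp add: finite_lists_length_eq)

lemma galois_number_0: "galois_number 0 n = (if n = 0 then 1 else 0)"
proof -
  have "{ks :: nat list. length ks = 0 \<and> sum_list ks = n} = (if n = 0 then {[]} else {})"
    by auto
  then show ?thesis
    unfolding galois_number_def by (simp add: q_multinomial_def)
qed

lemma galois_number_Suc:
  "galois_number (Suc m) n = (\<Sum>j\<le>n. q_binomial n j * galois_number m (n - j))"
proof -
  let ?C = "\<lambda>m n. {ks :: nat list. length ks = m \<and> sum_list ks = n}"
  have eq: "?C (Suc m) n = (\<lambda>(j, ks). ks @ [j]) ` (SIGMA j : {..n}. ?C m (n - j))"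
  proof (intro equalityI subsetI)
    fix ks assume ks: "ks \<in> ?C (Suc m) n"
    then obtain ks' j where "ks = ks' @ [j]"
      by (metis (mono_tags, lifting) length_Suc_conv_rev mem_Collect_eq)
    then show "ks \<in> (\<lambda>(j, ks). ks @ [j]) ` (SIGMA j : {..n}. ?C m (n - j))"
      using ks by (intro image_eqI[of _ _ "(j, ks')"]) auto
  qed auto
  have inj: "inj_on (\<lambda>(j, ks). ks @ [j]) (SIGMA j : {..n}. ?C m (n - j))"
    by (rule inj_onI) auto
  have "galois_number (Suc m) n
      = (\<Sum>(j, ks) \<in> (SIGMA j : {..n}. ?C m (n - j)). q_multinomial n (ks @ [j]))"
    unfolding galois_number_def eq
    by (subst sum.reindex[OF inj]) (simp add: case_prod_unfold comp_def)
  also have "\<dots> = (\<Sum>j\<le>n. \<Sum>ks \<in> ?C m (n - j). q_multinomial n (ks @ [j]))"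
    by (subst sum.Sigma) (auto intro: finite_compositions)
  also have "\<dots> = (\<Sum>j\<le>n. q_binomial n j * galois_number m (n - j))"
    by (simp add: q_multinomial_snoc galois_number_def sum_distrib_left)
  finally show ?thesis .
qed

lemma galois_number_1: "galois_number (Suc 0) n = 1"
proof -
  have "galois_number (Suc 0) n = (\<Sum>j\<le>n. if j = n then 1 else 0)"
    unfolding galois_number_Suc by (intro sum.cong) (auto simp: galois_number_0)
  then show ?thesis by simp
qed

text \<open>
  In the Pascal rule for \<open>[n + 1, j + 1]\<close>, the summands \<open>[n, j]\<close> reproduce the recursion of
  \<open>galois_number (Suc m) n\<close> and cancel; the others form the right-hand side.
\<close>
lemma galois_number_diff:
  "galois_number (Suc m) (Suc n) - galois_number (Suc m) n
     = (\<Sum>j\<le>n. monom 1 j * q_binomial n j * galois_number m (Suc n - j))"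
proof -
  let ?g = "galois_number m"
  have "galois_number (Suc m) (Suc n)
      = ?g (Suc n) + (\<Sum>j\<le>n. q_binomial (Suc n) (Suc j) * ?g (n - j))"
    unfolding galois_number_Suc by (subst sum.atMost_Suc_shift) simp
  also have "(\<Sum>j\<le>n. q_binomial (Suc n) (Suc j) * ?g (n - j))
      = galois_number (Suc m) n + (\<Sum>j\<le>n. monom 1 (Suc j) * q_binomial n (Suc j) * ?g (n - j))"
    unfolding galois_number_Suc by (simp add: q_binomial_Suc_Suc algebra_simps sum.distrib)
  also have "?g (Suc n) + (galois_number (Suc m) n
        + (\<Sum>j\<le>n. monom 1 (Suc j) * q_binomial n (Suc j) * ?g (n - j)))
      = galois_number (Suc m) n
        + (\<Sum>j\<le>Suc n. monom 1 j * q_binomial n j * ?g (Suc n - j))"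
    by (subst sum.atMost_Suc_shift) (simp add: monom_0)
  also have "(\<Sum>j\<le>Suc n. monom 1 j * q_binomial n j * ?g (Suc n - j))
      = (\<Sum>j\<le>n. monom 1 j * q_binomial n j * ?g (Suc n - j))"
    by (simp add: q_binomial_eq_0)
  finally show ?thesis by simp
qed

section \<open>Partitions\<close>

definition partitions_of_size :: "nat \<Rightarrow> nat \<Rightarrow> nat multiset set" where
  "partitions_of_size c i = {M. (\<forall>x \<in># M. 0 < x) \<and> sum_mset M = c \<and> size M = i}"

lemma size_le_sum_mset:
  fixes M :: "nat multiset"
  assumes "\<forall>x \<in># M. 0 < x"
  shows "size M \<le> sum_mset M"
  using assms by (induction M) auto

lemma sum_mset_image_Suc: "sum_mset (image_mset Suc M) = sum_mset M + size M"
  by (induction M) auto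

lemma finite_partitions_of_size: "finite (partitions_of_size c i)"
proof (rule finite_subset)
  show "partitions_of_size c i \<subseteq> mset ` {xs. set xs \<subseteq> {..c} \<and> length xs = i}"
  proof
    fix M assume M: "M \<in> partitions_of_size c i"
    obtain xs where xs: "M = mset xs" by (metis ex_mset)
    then have "set xs \<subseteq> {..c}"
      using M member_le_sum_list by (fastforce simp: partitions_of_size_def sum_mset_sum_list)
    then show "M \<in> mset ` {xs. set xs \<subseteq> {..c} \<and> length xs = i}"
      using M xs by (auto simp: partitions_of_size_def)
  qed
qed (simp add: finite_lists_length_eq)

lemma partitions_of_size_empty:
  assumes "c < i"
  shows "partitions_of_size c i = {}"
  using size_le_sum_mset assms by (fastforce simp: partitions_of_size_def)

lemma partitions_of_size_0_right: "partitions_of_size c 0 = (if c = 0 then {{#}} else {})"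
  by (auto simp: partitions_of_size_def)

text \<open>
  Either some part equals \<open>1\<close>, and one such part can be removed, or every one of the \<open>i + 1\<close> parts
  can be lowered by one. If \<open>c < i\<close>, the truncated difference is \<open>0\<close>, which has no partition into
  \<open>i + 1\<close> parts, as it should be.
\<close>
lemma card_partitions_of_size_Suc_Suc:
  "card (partitions_of_size (Suc c) (Suc i))
     = card (partitions_of_size c i) + card (partitions_of_size (c - i) (Suc i))"
proof -
  let ?A = "add_mset 1 ` partitions_of_size c i"
  let ?B = "image_mset Suc ` partitions_of_size (c - i) (Suc i)"
  have "partitions_of_size (Suc c) (Suc i) = ?A \<union> ?B"
  proof (intro equalityI subsetI)
    fix M assume M: "M \<in> partitions_of_size (Suc c) (Suc i)"
    show "M \<in> ?A \<union> ?B"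
    proof (cases "1 \<in># M")
      case True
      then obtain N where "M = add_mset 1 N" by (meson mset_add)
      then show ?thesis using M by (auto simp: partitions_of_size_def)
    next
      case False
      let ?N = "image_mset (\<lambda>x. x - 1) M"
      have gt: "\<forall>x \<in># M. 1 < x"
        using M False by (metis (mono_tags, lifting) One_nat_def Suc_lessI mem_Collect_eq
          partitions_of_size_def)
      then have "image_mset Suc ?N = image_mset id M"
        by (subst image_mset.compositionality, intro image_mset_cong) auto
      with gt have N: "M = image_mset Suc ?N" "\<forall>x \<in># ?N. 0 < x"
        by auto
      moreover have "sum_mset ?N = c - i"
        using M sum_mset_image_Suc[of ?N] N(1) by (simp add: partitions_of_size_def)
      ultimately have "?N \<in> partitions_of_size (c - i) (Suc i)"
        using M by (simp add: partitions_of_size_def)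
      then show ?thesis using N(1) by blast
    qed
  next
    fix M assume "M \<in> ?A \<union> ?B"
    then show "M \<in> partitions_of_size (Suc c) (Suc i)"
    proof
      assume "M \<in> ?B"
      then obtain N where N: "M = image_mset Suc N" "N \<in> partitions_of_size (c - i) (Suc i)"
        by blast
      then have "i < c"
        using partitions_of_size_empty[of "c - i" "Suc i"] by (cases "i < c") auto
      then show ?thesis
        using N by (auto simp: partitions_of_size_def sum_mset_image_Suc)
    qed (auto simp: partitions_of_size_def)
  qed
  moreover have "?A \<inter> ?B = {}"
  proof -
    have "1 \<in># M" if "M \<in> ?A" for M using that by auto
    moreover have "1 \<notin># M" if "M \<in> ?B" for M using that by (auto simp: partitions_of_size_def)
    ultimately show ?thesis by blast
  qed
  moreover have "card ?A = card (partitions_of_size c i)"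
    by (intro card_image inj_onI) simp
  moreover have "card ?B = card (partitions_of_size (c - i) (Suc i))"
    by (intro card_image inj_on_subset[OF multiset.inj_map]) auto
  ultimately show ?thesis
    by (simp add: card_Un_disjoint finite_partitions_of_size)
qed

text \<open>
  Multiplied by \<open>q\<^sup>i\<close>, the Pascal rule says that the coefficients of \<open>q\<^sup>i [n, i]\<close> satisfy the recursion
  of \<open>card_partitions_of_size_Suc_Suc\<close>. Both of its terms refer to a smaller \<open>c\<close> and to \<open>n - 1\<close>, hence the
  condition \<open>c \<le> n\<close> is inherited.
\<close>
lemma coeff_q_binomial_stable:
  assumes "c \<le> n"
  shows "coeff (monom 1 i * q_binomial n i) c = int (card (partitions_of_size c i))"
  using assms
proof (induction n arbitrary: i c)
  case 0
  then show ?case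
    by (cases i) (auto simp: q_binomial_eq_0 partitions_of_size_empty partitions_of_size_0_right)
next
  case (Suc n)
  show ?case
  proof (cases i)
    case 0
    then show ?thesis by (simp add: partitions_of_size_0_right)
  next
    case i: (Suc j)
    show ?thesis
    proof (cases c)
      case 0
      then show ?thesis using i by (simp add: coeff_monom_mult partitions_of_size_empty)
    next
      case c: (Suc d)
      have "monom 1 i * q_binomial (Suc n) i
          = monom 1 1 * (monom 1 j * q_binomial n j) + monom 1 i * (monom 1 i * q_binomial n i)"
        by (simp add: i q_binomial_Suc_Suc distrib_left mult_monom flip: mult.assoc)
      then have "coeff (monom 1 i * q_binomial (Suc n) i) c
          = coeff (monom 1 j * q_binomial n j) d
            + (if j \<le> d then coeff (monom 1 i * q_binomial n i) (d - j) else 0)"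
        by (simp only: coeff_add coeff_monom_mult[of 1 1] coeff_monom_mult[of 1 i "_ * _"]) (simp add: c i)
      also have "\<dots> = int (card (partitions_of_size d j))
          + (if j \<le> d then int (card (partitions_of_size (d - j) i)) else 0)"
        using Suc.IH[of d j] Suc.IH[of "d - j" i] Suc.prems c by simp
      also have "\<dots> = int (card (partitions_of_size c i))"
        by (simp add: c i card_partitions_of_size_Suc_Suc partitions_of_size_empty)
      finally show ?thesis .
    qed
  qed
qed

lemma partitions_with_kinds_0: "partitions_with_kinds 0 k = (if k = 0 then {[]} else {})"
  by (auto simp: partitions_with_kinds_def)

lemma partitions_with_kinds_Suc:
  "partitions_with_kinds (Suc m) k
     = (\<lambda>(c, P, Ps). P # Ps) `
         (SIGMA c : {..k}. (\<Union>i\<le>c. partitions_of_size c i) \<times> partitions_with_kinds m (k - c))"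
proof (intro equalityI subsetI)
  fix Qs assume Qs: "Qs \<in> partitions_with_kinds (Suc m) k"
  then obtain P Ps where P: "Qs = P # Ps"
    by (auto simp: partitions_with_kinds_def length_Suc_conv)
  have "size P \<le> sum_mset P"
    using Qs P by (intro size_le_sum_mset) (auto simp: partitions_with_kinds_def)
  then have "(sum_mset P, P, Ps) \<in>
      (SIGMA c : {..k}. (\<Union>i\<le>c. partitions_of_size c i) \<times> partitions_with_kinds m (k - c))"
    using Qs P by (auto simp: partitions_with_kinds_def partitions_of_size_def)
  then show "Qs \<in> (\<lambda>(c, P, Ps). P # Ps) `
      (SIGMA c : {..k}. (\<Union>i\<le>c. partitions_of_size c i) \<times> partitions_with_kinds m (k - c))"
    using P by (intro image_eqI[of _ _ "(sum_mset P, P, Ps)"]) simp_all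
qed (auto simp: partitions_with_kinds_def partitions_of_size_def)

lemma finite_partitions_with_kinds: "finite (partitions_with_kinds m k)"
  by (induction m arbitrary: k)
    (auto simp: partitions_with_kinds_0 partitions_with_kinds_Suc finite_partitions_of_size)

lemma card_partitions_with_kinds_Suc:
  "card (partitions_with_kinds (Suc m) k)
     = (\<Sum>c\<le>k. \<Sum>i\<le>c. card (partitions_of_size c i) * card (partitions_with_kinds m (k - c)))"
proof -
  let ?S = "SIGMA c : {..k}. (\<Union>i\<le>c. partitions_of_size c i) \<times> partitions_with_kinds m (k - c)"
  have "card (\<Union>i\<le>c. partitions_of_size c i) = (\<Sum>i\<le>c. card (partitions_of_size c i))" for c
    by (rule card_UN_disjoint)
      (simp_all add: finite_partitions_of_size, auto simp: partitions_of_size_def)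
  moreover have "inj_on (\<lambda>(c, P, Ps). P # Ps) ?S"
    by (rule inj_onI) (auto simp: partitions_of_size_def)
  then have "card (partitions_with_kinds (Suc m) k) = card ?S"
    unfolding partitions_with_kinds_Suc by (rule card_image)
  ultimately show ?thesis
    by (simp add: card_cartesian_product finite_partitions_of_size finite_partitions_with_kinds
        sum_distrib_right)
qed

section \<open>Backward differences\<close>

lemma backward_diff_funpow_Suc:
  "(backward_diff ^^ Suc m) f n = (backward_diff ^^ m) f n - (backward_diff ^^ m) f (n - 1)"
  by (simp only: funpow.simps comp_apply backward_diff_def[of "(backward_diff ^^ m) f" n])

text \<open>
  An iterated difference sees only a window of arguments. This allows the use of an
  identity for a difference that holds for large arguments only.
\<close>
lemma backward_diff_funpow_cong:
  assumes "\<And>x. n - m \<le> x \<Longrightarrow> x \<le> n \<Longrightarrow> f x = g x"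
  shows "(backward_diff ^^ m) f n = (backward_diff ^^ m) g n"
  using assms
proof (induction m arbitrary: n)
  case (Suc m)
  have "(backward_diff ^^ m) f n = (backward_diff ^^ m) g n"
    by (rule Suc.IH) (use Suc.prems in auto)
  moreover have "(backward_diff ^^ m) f (n - 1) = (backward_diff ^^ m) g (n - 1)"
    by (rule Suc.IH) (use Suc.prems in auto)
  ultimately show ?case by (simp only: backward_diff_funpow_Suc)
qed simp

lemma backward_diff_funpow_sum:
  "(backward_diff ^^ m) (\<lambda>x. \<Sum>i\<in>A. f i x) n = (\<Sum>i\<in>A. (backward_diff ^^ m) (f i) n)"
  by (induction m arbitrary: n) (simp_all add: backward_diff_funpow_Suc sum_subtractf del: funpow.simps(2))

lemma backward_diff_funpow_mult:
  "(backward_diff ^^ m) (\<lambda>x. a * f x) n = a * (backward_diff ^^ m) f n"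
  by (induction m arbitrary: n) (simp_all add: backward_diff_funpow_Suc right_diff_distrib del: funpow.simps(2))

text \<open>
  Truncation is harmless here: subtracting \<open>i\<close> and subtracting \<open>1\<close> commute on natural numbers, even when
  they truncate.
\<close>
lemma backward_diff_funpow_shift:
  "(backward_diff ^^ m) (\<lambda>x. f (x - i)) n = (backward_diff ^^ m) f (n - i)"
  by (induction m arbitrary: n) (simp_all add: backward_diff_funpow_Suc diff_commute del: funpow.simps(2))

section \<open>Differences of Galois numbers\<close>

text \<open>
  The coefficientwise form of \<open>galois_number_diff\<close>. As \<open>k < n\<close>, all coefficients of the kernel that
  enter are in the stable range, so the weights do not depend on \<open>n\<close>.
\<close>
lemma backward_diff_coeff_galois_number:
  assumes "k < n"
  shows "backward_diff (\<lambda>n. coeff (galois_number (Suc m) n) k) n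
    = (\<Sum>c\<le>k. \<Sum>i\<le>c. int (card (partitions_of_size c i)) * coeff (galois_number m (n - i)) (k - c))"
proof -
  obtain N where N: "n = Suc N" "k \<le> N" using assms by (cases n) auto
  have "backward_diff (\<lambda>n. coeff (galois_number (Suc m) n) k) n
      = coeff (galois_number (Suc m) (Suc N) - galois_number (Suc m) N) k"
    by (simp add: backward_diff_def N)
  also have "\<dots> = (\<Sum>i\<le>N. \<Sum>c\<le>k. coeff (monom 1 i * q_binomial N i) c
        * coeff (galois_number m (n - i)) (k - c))"
    unfolding galois_number_diff by (simp add: coeff_sum coeff_mult N)
  also have "\<dots> = (\<Sum>c\<le>k. \<Sum>i\<le>N. int (card (partitions_of_size c i))
        * coeff (galois_number m (n - i)) (k - c))"
    using N by (subst sum.swap) (intro sum.cong refl, simp add: coeff_q_binomial_stable)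
  also have "\<dots> = (\<Sum>c\<le>k. \<Sum>i\<le>c. int (card (partitions_of_size c i))
        * coeff (galois_number m (n - i)) (k - c))"
    using N by (intro sum.cong refl sum.mono_neutral_right) (auto simp: partitions_of_size_empty)
  finally show ?thesis .
qed

theorem theorem3p10:
  fixes m n k :: nat
  assumes "n \<ge> m + k"
  shows "(backward_diff ^^ m) (\<lambda>n'. coeff (galois_number (m + 1) n') k) n =
           int (card (partitions_with_kinds m k))"
  using assms
proof (induction m arbitrary: n k)
  case 0
  then show ?case
    by (simp add: galois_number_1 partitions_with_kinds_0)
next
  case (Suc m)
  let ?f = "\<lambda>m k n. coeff (galois_number m n) k"
  have "(backward_diff ^^ Suc m) (?f (Suc m + 1) k) n
      = (backward_diff ^^ m) (backward_diff (?f (Suc m + 1) k)) n"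
    by (simp only: funpow_Suc_right comp_apply)
  also have "\<dots> = (backward_diff ^^ m) (\<lambda>x. \<Sum>c\<le>k. \<Sum>i\<le>c.
      int (card (partitions_of_size c i)) * ?f (m + 1) (k - c) (x - i)) n"
  proof (rule backward_diff_funpow_cong)
    fix x assume "n - m \<le> x"
    \<comment> \<open>The whole window of arguments lies in the range where the convolution formula holds.\<close>
    with Suc.prems have "k < x" by simp
    from backward_diff_coeff_galois_number[OF this, of "Suc m"]
    show "backward_diff (?f (Suc m + 1) k) x = (\<Sum>c\<le>k. \<Sum>i\<le>c.
      int (card (partitions_of_size c i)) * ?f (m + 1) (k - c) (x - i))"
      by simp
  qed
  also have "\<dots> = (\<Sum>c\<le>k. \<Sum>i\<le>c. int (card (partitions_of_size c i))
      * (backward_diff ^^ m) (?f (m + 1) (k - c)) (n - i))"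
    by (simp only: backward_diff_funpow_sum backward_diff_funpow_mult
        backward_diff_funpow_shift[of m "?f (m + 1) _"])
  \<comment> \<open>The induction hypothesis applies since \<open>i \<le> c \<le> k\<close> gives \<open>n - i \<ge> m + (k - c)\<close>.\<close>
  also have "\<dots> = (\<Sum>c\<le>k. \<Sum>i\<le>c. int (card (partitions_of_size c i))
      * int (card (partitions_with_kinds m (k - c))))"
    using Suc.prems by (intro sum.cong refl arg_cong2[of _ _ _ _ "(*)"] Suc.IH) auto
  also have "\<dots> = int (card (partitions_with_kinds (Suc m) k))"
    by (simp add: card_partitions_with_kinds_Suc)
  finally show ?case .
qed

end
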